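(* Let $x,y\in\mathbb{R}[X]$ with $\deg x=\deg y=2$, and let $\gamma\in\mathbb{R}[X]$ be a polynomial without real roots such that $p=x/\gamma$ and $q=y/\gamma$ lie in $D$. If $\gcd(x,y)$ is not a constant, then $\begin{pmatrix} p & q\\ 0 & 0\end{pmatrix}$ is a product of idempotent $2\times 2$ matrices over $D$.
   Context: $D$ denotes the minimal Dress ring of the field $\mathbb{R}(X)$, i.e. the subring of $\mathbb{R}(X)$ generated by $\mathbb{Z}$ and all elements $1/(1+h^2)$ with $h\in\mathbb{R}(X)$. A matrix $E$ is idempotent if $E^2=E$. *)

theory Defs
  imports "HOL-Analysis.Analysis" "HOL-Computational_Algebra.Polynomial_Factorial" "HOL-Computational_Algebra.Field_as_Ring"
    "HOL-Computational_Algebra.Fraction_Field"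
begin

text \<open>The field R(X) is rendered as real poly fract.
  The minimal Dress ring D: the subring generated by the integers and all
  elements 1/(1+h^2), h in R(X).\<close>

inductive_set dress_min :: "real poly fract set" where
  of_int: "of_int n \<in> dress_min"
| inv_sq: "inverse (1 + h ^ 2) \<in> dress_min"
| add: "a \<in> dress_min \<Longrightarrow> b \<in> dress_min \<Longrightarrow> a + b \<in> dress_min"
| neg: "a \<in> dress_min \<Longrightarrow> - a \<in> dress_min"
| mult: "a \<in> dress_min \<Longrightarrow> b \<in> dress_min \<Longrightarrow> a * b \<in> dress_min"

definition mat2 :: "'a::zero \<Rightarrow> 'a \<Rightarrow> 'a \<Rightarrow> 'a \<Rightarrow> 'a ^ 2 ^ 2" where
  "mat2 a b c d = (\<chi> i j. if i = 1 then (if j = 1 then a else b)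
                          else (if j = 1 then c else d))"

definition matrix_over :: "'a set \<Rightarrow> 'a ^ 2 ^ 2 \<Rightarrow> bool" where
  "matrix_over S E \<longleftrightarrow> (\<forall>i j. E $ i $ j \<in> S)"

definition idempotent_mat :: "'a::semiring_1 ^ 2 ^ 2 \<Rightarrow> bool" where
  "idempotent_mat E \<longleftrightarrow> E ** E = E"

definition product_of_idempotents_over :: "'a::semiring_1 set \<Rightarrow> 'a ^ 2 ^ 2 \<Rightarrow> bool" where
  "product_of_idempotents_over S M \<longleftrightarrow>
     (\<exists>Es. Es \<noteq> [] \<and> (\<forall>E \<in> set Es. matrix_over S E \<and> idempotent_mat E)
           \<and> M = foldr (**) Es (mat 1))"

end

theory Submission
  imports Defs "HOL-Computational_Algebra.Fundamental_Theorem_Algebra"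
begin

text \<open>Every element of \<open>D\<close> is a proper rational function, so \<open>deg \<gamma> \<ge> 2\<close>. Since
  \<open>1/(1 + h\<^sup>2) \<in> D\<close> for all \<open>h\<close>, also \<open>h/(1 + h\<^sup>2)\<close> and \<open>h\<^sup>2/(1 + h\<^sup>2)\<close> lie in \<open>D\<close>;
  factoring \<open>\<gamma>\<close> into real quadratics \<open>(X - \<mu>)\<^sup>2 + \<nu>\<^sup>2\<close> then shows \<open>f/\<gamma> \<in> D\<close> whenever
  \<open>deg f \<le> deg \<gamma>\<close>.

  If \<open>y = \<kappa> x\<close>, the matrix is \<open>[1 q; 0 0] [0 0; \<kappa>\<^sup>-\<^sup>1 1]\<close>. Otherwise \<open>x = s r\<^sub>1\<close>, \<open>y = s r\<^sub>2\<close>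
  with a common linear factor \<open>s\<close> and non-proportional linear \<open>r\<^sub>1, r\<^sub>2\<close>. Linear \<open>a\<^sub>1, a\<^sub>2\<close>
  with \<open>a\<^sub>1 r\<^sub>1 + a\<^sub>2 r\<^sub>2 = G = X\<^sup>2 + 1\<close> give the rank-one idempotent
  \<open>(a\<^sub>1, a\<^sub>2)\<^sup>T (r\<^sub>1, r\<^sub>2) / G\<close> with entries in \<open>D\<close>, and choosing them so that
  \<open>c a\<^sub>1 + a\<^sub>2\<close> is a multiple of \<open>s\<close> makes \<open>[1 \<beta>; 0 0] [0 0; c 1]\<close> times this idempotent equal
  to \<open>[x/\<gamma> y/\<gamma>; 0 0]\<close>, where \<open>\<beta>\<close> is a real multiple of \<open>G/\<gamma> \<in> D\<close>.\<close>

section \<open>Real constants\<close>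

abbreviation const_fract :: "real \<Rightarrow> real poly fract" where
  "const_fract r \<equiv> to_fract [:r:]"

lemma const_fract_add: "const_fract (r + s) = const_fract r + const_fract s"
  by (simp flip: to_fract_add)

lemma const_fract_mult: "const_fract (r * s) = const_fract r * const_fract s"
  by (simp flip: to_fract_mult)

lemma const_fract_uminus: "const_fract (- r) = - const_fract r"
  by (simp flip: to_fract_uminus)

lemma const_fract_diff: "const_fract (r - s) = const_fract r - const_fract s"
  by (simp flip: to_fract_diff)

lemma const_fract_1: "const_fract 1 = 1"
  by (simp flip: one_pCons)

lemma const_fract_of_nat: "const_fract (of_nat n) = of_nat n"
  by (induction n) (simp_all add: const_fract_add const_fract_1)

lemma const_fract_numeral: "const_fract (numeral k) = numeral k"
  using const_fract_of_nat[of "numeral k"] by simp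

lemma const_fract_inverse: "const_fract (inverse r) = inverse (const_fract r)"
proof (cases "r = 0")
  case False
  then have "const_fract (inverse r) * const_fract r = 1"
    by (simp flip: const_fract_mult add: const_fract_1)
  with False show ?thesis
    by (simp add: field_simps)
qed simp

lemma const_fract_divide: "const_fract (r / s) = const_fract r / const_fract s"
  by (simp add: divide_inverse const_fract_mult const_fract_inverse)

lemma const_fract_power: "const_fract (r ^ n) = const_fract r ^ n"
  by (induction n) (simp_all add: const_fract_1 const_fract_mult)

lemma to_fract_smult: "to_fract (smult k p) = const_fract k * to_fract p"
  by (simp flip: to_fract_mult)

lemmas const_fract_simps = const_fract_add const_fract_mult const_fract_uminus const_fract_diff
  const_fract_1 const_fract_numeral const_fract_inverse const_fract_divide const_fract_power

lemma dress_min_0: "0 \<in> dress_min"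
  using dress_min.of_int[of 0] by simp

lemma dress_min_1: "1 \<in> dress_min"
  using dress_min.of_int[of 1] by simp

lemma dress_min_of_nat: "of_nat n \<in> dress_min"
  using dress_min.of_int[of "int n"] by simp

lemma dress_min_diff: "a \<in> dress_min \<Longrightarrow> b \<in> dress_min \<Longrightarrow> a - b \<in> dress_min"
  using dress_min.add[of a "- b"] dress_min.neg[of b] by simp

text \<open>Every \<open>s \<in> (0, 1]\<close> is \<open>1/(1 + t\<^sup>2)\<close> for a real \<open>t\<close>, and every real is \<open>2n s - n\<close>
  for such an \<open>s\<close> and some natural number \<open>n\<close>.\<close>
lemma const_fract_in_dress_min: "const_fract r \<in> dress_min"
proof -
  define n :: nat where "n = nat \<lceil>\<bar>r\<bar>\<rceil> + 1"
  have n: "\<bar>r\<bar> < real n"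
    unfolding n_def by linarith
  define s where "s = (r + n) / (2 * n)"
  have s: "0 < s" "s < 1"
    using n unfolding s_def by (auto simp: field_simps)
  define t where "t = sqrt (1 / s - 1)"
  have "1 + t\<^sup>2 = 1 / s"
    unfolding t_def using s by simp
  then have "inverse (1 + const_fract t ^ 2) = const_fract s"
    by (simp flip: const_fract_power const_fract_add const_fract_1 const_fract_inverse)
  then have "const_fract s \<in> dress_min"
    by (metis dress_min.inv_sq)
  moreover have "const_fract r = of_nat (2 * n) * const_fract s - of_nat n"
  proof -
    have "r = real (2 * n) * s - real n"
      unfolding s_def using n by (simp add: field_simps)
    then show ?thesis
      by (metis const_fract_diff const_fract_mult const_fract_of_nat)
  qed
  ultimately show ?thesis
    by (metis dress_min.mult dress_min_diff dress_min_of_nat)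
qed

lemma const_fract_mult_in_dress_min: "a \<in> dress_min \<Longrightarrow> const_fract r * a \<in> dress_min"
  by (rule dress_min.mult[OF const_fract_in_dress_min])

section \<open>Elements of \<open>D\<close> are proper rational functions\<close>

lemma coeff_mult_self_double:
  fixes p :: "real poly"
  assumes "degree p \<le> k"
  shows "coeff (p * p) (2 * k) = (if degree p = k then (lead_coeff p)\<^sup>2 else 0)"
proof (cases "degree p = k")
  case True
  then show ?thesis
    using coeff_mult_degree_sum[of p p] by (simp add: power2_eq_square mult_2)
next
  case False
  then have "degree (p * p) < 2 * k"
    using degree_mult_le[of p p] assms by linarith
  with False show ?thesis
    by (simp add: coeff_eq_0)
qed

text \<open>The top coefficient of \<open>d\<^sup>2 + n\<^sup>2\<close> in degree \<open>2 max (deg d) (deg n)\<close> is a sum of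
  squares of leading coefficients, at least one of them nonzero.\<close>
lemma sum_squares_poly:
  fixes d n :: "real poly"
  assumes "d \<noteq> 0"
  shows "d * d + n * n \<noteq> 0" and "degree (d * d) \<le> degree (d * d + n * n)"
proof -
  define k where "k = max (degree d) (degree n)"
  have top: "coeff (d * d + n * n) (2 * k) =
      (if degree d = k then (lead_coeff d)\<^sup>2 else 0) + (if degree n = k then (lead_coeff n)\<^sup>2 else 0)"
    using coeff_mult_self_double[of d k] coeff_mult_self_double[of n k] unfolding k_def by simp
  have "coeff (d * d + n * n) (2 * k) > 0"
  proof (cases "degree d = k")
    case True
    with assms have "coeff d k \<noteq> 0"
      by auto
    with top True show ?thesis
      by (simp add: sum_power2_gt_zero_iff)
  next
    case False
    then have "degree n = k" "n \<noteq> 0"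
      unfolding k_def by (auto simp: max_def split: if_splits)
    with top False show ?thesis
      using leading_coeff_neq_0[of n] by simp
  qed
  then have "2 * k \<le> degree (d * d + n * n)" "d * d + n * n \<noteq> 0"
    by (auto intro: le_degree)
  moreover have "degree (d * d) \<le> 2 * k"
    using degree_mult_le[of d d] unfolding k_def by linarith
  ultimately show "d * d + n * n \<noteq> 0" "degree (d * d) \<le> degree (d * d + n * n)"
    by auto
qed

definition proper_fract :: "real poly fract \<Rightarrow> bool" where
  "proper_fract f \<longleftrightarrow> (\<exists>n d. d \<noteq> 0 \<and> f = Fract n d \<and> degree n \<le> degree d)"

lemma of_int_fract: "(of_int k :: 'a::idom fract) = Fract (of_int k) 1"
  by (induction k rule: int_induct[where k = 0]) (simp_all add: Zero_fract_def One_fract_def)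

lemma one_plus_square_Fract:
  assumes "d \<noteq> 0"
  shows "1 + (Fract n d)\<^sup>2 = Fract (d * d + n * n) (d * d)"
proof -
  have "1 + (Fract n d)\<^sup>2 = Fract 1 1 + Fract (n * n) (d * d)"
    by (simp add: power2_eq_square fract_collapse)
  also have "\<dots> = Fract (d * d + n * n) (d * d)"
    using assms by (simp add: add.commute)
  finally show ?thesis .
qed

lemma proper_fract_if_dress_min: "f \<in> dress_min \<Longrightarrow> proper_fract f"
proof (induction rule: dress_min.induct)
  case (of_int k)
  show ?case
    unfolding proper_fract_def of_int_fract by (intro exI[of _ "of_int k"] exI[of _ 1]) (simp add: of_int_poly)
next
  case (inv_sq h)
  obtain n d where h: "h = Fract n d" "d \<noteq> 0"
    by (cases h)
  have "inverse (1 + h\<^sup>2) = Fract (d * d) (d * d + n * n)"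
    by (simp add: h one_plus_square_Fract)
  then show ?case
    unfolding proper_fract_def using sum_squares_poly[OF h(2), of n] by blast
next
  case (add a b)
  then obtain n1 d1 n2 d2 where
    a: "d1 \<noteq> 0" "a = Fract n1 d1" "degree n1 \<le> degree d1" and
    b: "d2 \<noteq> 0" "b = Fract n2 d2" "degree n2 \<le> degree d2"
    unfolding proper_fract_def by blast
  have "degree (n1 * d2 + n2 * d1) \<le> degree (d1 * d2)"
    using degree_add_le_max[of "n1 * d2" "n2 * d1"] degree_mult_le[of n1 d2] degree_mult_le[of n2 d1]
      degree_mult_eq[OF a(1) b(1)] a(3) b(3) by linarith
  with a b show ?case
    unfolding proper_fract_def by (intro exI[of _ "n1 * d2 + n2 * d1"] exI[of _ "d1 * d2"]) simp
next
  case (neg a)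
  then obtain n d where "d \<noteq> 0" "a = Fract n d" "degree n \<le> degree d"
    unfolding proper_fract_def by blast
  then show ?case
    unfolding proper_fract_def by (intro exI[of _ "- n"] exI[of _ d]) simp
next
  case (mult a b)
  then obtain n1 d1 n2 d2 where
    a: "d1 \<noteq> 0" "a = Fract n1 d1" "degree n1 \<le> degree d1" and
    b: "d2 \<noteq> 0" "b = Fract n2 d2" "degree n2 \<le> degree d2"
    unfolding proper_fract_def by blast
  have "degree (n1 * n2) \<le> degree (d1 * d2)"
    using degree_mult_le[of n1 n2] degree_mult_eq[OF a(1) b(1)] a(3) b(3) by linarith
  with a b show ?case
    unfolding proper_fract_def by (intro exI[of _ "n1 * n2"] exI[of _ "d1 * d2"]) simp
qed

lemma degree_le_if_Fract_in_dress_min: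
  fixes x g :: "real poly"
  assumes "Fract x g \<in> dress_min" and "g \<noteq> 0"
  shows "degree x \<le> degree g"
proof (cases "x = 0")
  case False
  obtain n d where nd: "d \<noteq> 0" "Fract x g = Fract n d" "degree n \<le> degree d"
    using proper_fract_if_dress_min[OF assms(1)] unfolding proper_fract_def by blast
  then have "x * d = n * g"
    using eq_fract(1)[OF assms(2) nd(1)] by blast
  moreover from this have "n \<noteq> 0"
    using False nd(1) by auto
  ultimately have "degree x + degree d = degree n + degree g"
    by (metis False assms(2) degree_mult_eq nd(1))
  with nd(3) show ?thesis
    by linarith
qed simp

lemma one_plus_square_fract_nonzero: "1 + h\<^sup>2 \<noteq> (0 :: real poly fract)"
proof -
  obtain n d where h: "h = Fract n d" "d \<noteq> 0"
    by (cases h)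
  then have "1 + h\<^sup>2 = Fract (d * d + n * n) (d * d)"
    by (simp add: one_plus_square_Fract)
  moreover have "d * d + n * n \<noteq> 0"
    using sum_squares_poly(1)[OF h(2)] .
  ultimately show ?thesis
    using h(2) by (simp add: Zero_fract_def eq_fract)
qed

section \<open>Denominators without real roots\<close>

lemma square_divide_one_plus_square_in_dress_min: "t\<^sup>2 / (1 + t\<^sup>2) \<in> dress_min"
proof -
  have "t\<^sup>2 / (1 + t\<^sup>2) = 1 - inverse (1 + t\<^sup>2)"
    using one_plus_square_fract_nonzero[of t] by (simp add: field_simps)
  then show ?thesis
    by (metis dress_min.inv_sq dress_min_1 dress_min_diff)
qed

text \<open>With \<open>h = (1 - t) / (1 + t)\<close> one has \<open>1 / (1 + h\<^sup>2) = 1/2 + t / (1 + t\<^sup>2)\<close>.\<close>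
lemma divide_one_plus_square_in_dress_min: "t / (1 + t\<^sup>2) \<in> dress_min"
proof (cases "1 + t = 0")
  case True
  then have "t / (1 + t\<^sup>2) = const_fract (- 1 / 2)"
    by (simp add: const_fract_simps eq_neg_iff_add_eq_0[symmetric] field_simps)
  then show ?thesis
    by (simp add: const_fract_in_dress_min)
next
  case False
  define h where "h = (1 - t) / (1 + t)"
  have "1 + h\<^sup>2 = ((1 + t)\<^sup>2 + (1 - t)\<^sup>2) / (1 + t)\<^sup>2"
    unfolding h_def using False by (simp add: field_simps)
  also have "(1 + t)\<^sup>2 + (1 - t)\<^sup>2 = 2 * (1 + t\<^sup>2)"
    by (simp add: power2_eq_square algebra_simps)
  finally have "1 + h\<^sup>2 = 2 * (1 + t\<^sup>2) / (1 + t)\<^sup>2" .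
  then have "inverse (1 + h\<^sup>2) = const_fract (1 / 2) + t / (1 + t\<^sup>2)"
    using False one_plus_square_fract_nonzero[of t]
    by (simp add: const_fract_simps field_simps power2_eq_square)
  then have "t / (1 + t\<^sup>2) = inverse (1 + h\<^sup>2) - const_fract (1 / 2)"
    by simp
  then show ?thesis
    by (simp add: dress_min_diff dress_min.inv_sq const_fract_in_dress_min)
qed

definition dress_denom :: "real poly \<Rightarrow> bool" where
  "dress_denom g \<longleftrightarrow> (\<forall>f. degree f \<le> degree g \<longrightarrow> Fract f g \<in> dress_min)"

lemma dress_denom_const:
  assumes "c \<noteq> 0"
  shows "dress_denom [:c:]"
  unfolding dress_denom_def
proof (intro allI impI)
  fix f :: "real poly"
  assume "degree f \<le> degree [:c:]"
  then have "f = [:coeff f 0:]"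
    by (simp add: degree_0_id)
  then have "Fract f [:c:] = const_fract (coeff f 0 / c)"
    by (metis Fract_conv_to_fract const_fract_divide)
  then show "Fract f [:c:] \<in> dress_min"
    by (simp add: const_fract_in_dress_min)
qed

lemma degree_le_2_expand_at:
  fixes f :: "real poly"
  assumes "degree f \<le> 2"
  shows "f = [:coeff f 0 + coeff f 1 * \<mu> + coeff f 2 * \<mu>\<^sup>2:] + [:coeff f 1 + 2 * coeff f 2 * \<mu>:] * [:- \<mu>, 1:]
    + [:coeff f 2:] * [:- \<mu>, 1:]\<^sup>2"
proof -
  have "f = [:coeff f 0, coeff f 1, coeff f 2:]"
    using assms by (intro poly_eqI) (auto simp: coeff_pCons coeff_eq_0 numeral_2_eq_2 split: nat.split)
  then show ?thesis
    by (subst poly_eq_poly_eq_iff[symmetric]) (auto simp: fun_eq_iff algebra_simps power2_eq_square)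
qed

lemma dress_denom_mult:
  assumes "g1 \<noteq> 0" "g2 \<noteq> 0" "dress_denom g1" "dress_denom g2"
  shows "dress_denom (g1 * g2)"
  unfolding dress_denom_def
proof (intro allI impI)
  fix f :: "real poly"
  assume "degree f \<le> degree (g1 * g2)"
  then have deg_f: "degree f \<le> degree g1 + degree g2"
    using degree_mult_eq[OF assms(1,2)] by simp
  define k where "k = degree g1"
  define low where "low = poly_cutoff k f"
  define high where "high = poly_shift k f"
  have "f = low + monom 1 k * high"
    by (rule poly_eqI) (simp add: low_def high_def coeff_poly_cutoff coeff_poly_shift coeff_monom_mult)
  then have split: "Fract f (g1 * g2) = Fract low g1 * Fract 1 g2 + Fract (monom 1 k) g1 * Fract high g2"
    using assms(1,2) by (simp add: eq_fract algebra_simps)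
  have "degree low \<le> degree g1"
    by (rule degree_le) (simp add: low_def coeff_poly_cutoff k_def)
  moreover have "degree high \<le> degree g2"
    by (rule degree_le) (use deg_f in \<open>auto simp: high_def k_def coeff_poly_shift intro: coeff_eq_0\<close>)
  moreover have "degree (monom (1::real) k) \<le> degree g1"
    by (simp add: degree_monom_eq k_def)
  ultimately show "Fract f (g1 * g2) \<in> dress_min"
    using assms(3,4) unfolding split dress_denom_def by (intro dress_min.add dress_min.mult) auto
qed

lemma quadratic_divide_scaled_one_plus_square:
  fixes n t :: "'a::field"
  assumes "n \<noteq> 0" and "1 + t\<^sup>2 \<noteq> 0"
  shows "(a0 + a1 * (n * t) + a2 * (n * t)\<^sup>2) / ((n * t)\<^sup>2 + n * n)
    = a0 / n\<^sup>2 * inverse (1 + t\<^sup>2) + a1 / n * (t / (1 + t\<^sup>2)) + a2 * (t\<^sup>2 / (1 + t\<^sup>2))"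
proof -
  define s where "s = 1 + t\<^sup>2"
  have "s \<noteq> 0" and "(n * t)\<^sup>2 + n * n = n\<^sup>2 * s"
    unfolding s_def using assms(2) by (simp_all add: power2_eq_square algebra_simps)
  with assms(1) show ?thesis
    unfolding s_def[symmetric] by (simp add: field_simps power2_eq_square)
qed

lemma degree_shifted_sum_square: "degree ([:- \<mu>, 1:]\<^sup>2 + [:\<nu>\<^sup>2:]) = (2 :: nat)"
  for \<mu> \<nu> :: real
proof -
  have "degree ([:- \<mu>, 1:]\<^sup>2) = 2"
    by (subst degree_power_eq) simp_all
  then show ?thesis
    by (subst degree_add_eq_left) simp_all
qed

lemma dress_denom_quadratic:
  fixes \<mu> \<nu> :: real
  assumes "\<nu> \<noteq> 0"
  shows "dress_denom ([:- \<mu>, 1:]\<^sup>2 + [:\<nu>\<^sup>2:])"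
  unfolding dress_denom_def
proof (intro allI impI)
  fix f :: "real poly"
  assume "degree f \<le> degree ([:- \<mu>, 1:]\<^sup>2 + [:\<nu>\<^sup>2:])"
  then have f: "f = [:coeff f 0 + coeff f 1 * \<mu> + coeff f 2 * \<mu>\<^sup>2:]
      + [:coeff f 1 + 2 * coeff f 2 * \<mu>:] * [:- \<mu>, 1:] + [:coeff f 2:] * [:- \<mu>, 1:]\<^sup>2"
    by (intro degree_le_2_expand_at) (simp add: degree_shifted_sum_square)
  define t where "t = to_fract [:- \<mu>, 1:] / const_fract \<nu>"
  have \<nu>: "const_fract \<nu> \<noteq> 0"
    using assms by simp
  have T: "to_fract [:- \<mu>, 1:] = const_fract \<nu> * t"
    unfolding t_def using \<nu> by simp
  have "to_fract ([:- \<mu>, 1:]\<^sup>2 + [:\<nu>\<^sup>2:]) = (const_fract \<nu> * t)\<^sup>2 + const_fract \<nu> * const_fract \<nu>"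
    by (simp only: power2_eq_square to_fract_add to_fract_mult T const_fract_mult)
  moreover have "to_fract f = const_fract (coeff f 0 + coeff f 1 * \<mu> + coeff f 2 * \<mu>\<^sup>2)
        + const_fract (coeff f 1 + 2 * coeff f 2 * \<mu>) * (const_fract \<nu> * t)
        + const_fract (coeff f 2) * (const_fract \<nu> * t)\<^sup>2"
    using arg_cong[OF f, of to_fract] by (simp only: power2_eq_square to_fract_add to_fract_mult T)
  ultimately have "Fract f ([:- \<mu>, 1:]\<^sup>2 + [:\<nu>\<^sup>2:]) =
      const_fract (coeff f 0 + coeff f 1 * \<mu> + coeff f 2 * \<mu>\<^sup>2) / const_fract \<nu> ^ 2 * inverse (1 + t\<^sup>2)
      + const_fract (coeff f 1 + 2 * coeff f 2 * \<mu>) / const_fract \<nu> * (t / (1 + t\<^sup>2))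
      + const_fract (coeff f 2) * (t\<^sup>2 / (1 + t\<^sup>2))"
    using quadratic_divide_scaled_one_plus_square[OF \<nu> one_plus_square_fract_nonzero]
    by (simp only: Fract_conv_to_fract)
  also have "\<dots> \<in> dress_min"
    unfolding const_fract_power[symmetric] const_fract_divide[symmetric]
    by (intro dress_min.add const_fract_mult_in_dress_min dress_min.inv_sq
        divide_one_plus_square_in_dress_min square_divide_one_plus_square_in_dress_min)
  finally show "Fract f ([:- \<mu>, 1:]\<^sup>2 + [:\<nu>\<^sup>2:]) \<in> dress_min" .
qed

abbreviation complex_poly :: "real poly \<Rightarrow> complex poly" where
  "complex_poly p \<equiv> map_poly complex_of_real p"

lemma complex_poly_add: "complex_poly (p + q) = complex_poly p + complex_poly q"
  by (rule poly_eqI) (simp add: coeff_map_poly)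

lemma complex_poly_pCons: "complex_poly (pCons a p) = pCons (of_real a) (complex_poly p)"
  by (rule map_poly_pCons) simp

lemma complex_poly_mult: "complex_poly (p * q) = complex_poly p * complex_poly q"
proof (induction p)
  case (pCons a p)
  have "complex_poly (smult a q) = smult (of_real a) (complex_poly q)"
    by (rule poly_eqI) (simp add: coeff_map_poly)
  with pCons show ?case
    by (simp add: complex_poly_add complex_poly_pCons)
qed simp

lemma poly_complex_poly_of_real: "poly (complex_poly p) (of_real t) = of_real (poly p t)"
  by (induction p) (simp_all add: complex_poly_pCons)

text \<open>A non-real complex root \<open>\<mu> + i\<nu>\<close> of \<open>g\<close> is a root of the remainder of \<open>g\<close> modulo
  \<open>(X - \<mu>)\<^sup>2 + \<nu>\<^sup>2\<close>, and a real linear polynomial vanishing there is zero.\<close>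
lemma quadratic_factor_if_no_real_roots:
  fixes g :: "real poly"
  assumes no_roots: "\<forall>t. poly g t \<noteq> 0" and "degree g > 0"
  obtains \<mu> \<nu> s where "\<nu> \<noteq> 0" and "g = ([:- \<mu>, 1:]\<^sup>2 + [:\<nu>\<^sup>2:]) * s"
proof -
  have "\<not> constant (poly (complex_poly g))"
  proof
    assume "constant (poly (complex_poly g))"
    then have "degree (complex_poly g) = 0"
      using constant_degree by blast
    with \<open>degree g > 0\<close> show False
      by (simp add: degree_map_poly)
  qed
  then obtain z where z: "poly (complex_poly g) z = 0"
    using fundamental_theorem_of_algebra by blast
  define \<mu> where "\<mu> = Re z"
  define \<nu> where "\<nu> = Im z"
  have "\<nu> \<noteq> 0"
  proof
    assume "\<nu> = 0"
    then have "z = of_real \<mu>"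
      unfolding \<mu>_def \<nu>_def by (simp add: complex_eq_iff)
    with z no_roots show False
      by (simp add: poly_complex_poly_of_real)
  qed
  define q where "q = [:- \<mu>, 1:]\<^sup>2 + [:\<nu>\<^sup>2:]"
  have "degree q = 2"
    unfolding q_def by (rule degree_shifted_sum_square)
  then have "q \<noteq> 0"
    by auto
  define r where "r = g mod q"
  have "degree r \<le> 1"
    using degree_mod_less[OF \<open>q \<noteq> 0\<close>, of g] \<open>degree q = 2\<close> unfolding r_def by (cases "r = 0") auto
  then have r: "r = [:coeff r 0, coeff r 1:]"
    by (intro poly_eqI) (auto simp: coeff_pCons coeff_eq_0 split: nat.split)
  have "poly (complex_poly q) z = (z - of_real \<mu>)\<^sup>2 + (of_real \<nu>)\<^sup>2"
    unfolding q_def by (simp add: complex_poly_add complex_poly_mult complex_poly_pCons power2_eq_square algebra_simps)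
  also have "\<dots> = 0"
    unfolding \<mu>_def \<nu>_def by (simp add: complex_eq_iff power2_eq_square)
  moreover have "complex_poly g = complex_poly (g div q) * complex_poly q + complex_poly r"
    unfolding r_def by (simp only: complex_poly_add[symmetric] complex_poly_mult[symmetric] div_mult_mod_eq)
  ultimately have "poly (complex_poly r) z = 0"
    using z by simp
  then have "of_real (coeff r 0) + of_real (coeff r 1) * z = 0"
    by (subst (asm) r) (simp add: complex_poly_pCons mult.commute)
  then have "coeff r 1 * \<nu> = 0" and "coeff r 0 + coeff r 1 * \<mu> = 0"
    unfolding \<mu>_def \<nu>_def by (simp_all add: complex_eq_iff)
  with \<open>\<nu> \<noteq> 0\<close> r have "r = 0"
    by simp
  then have "g = q * (g div q)"
    using div_mult_mod_eq[of g q] unfolding r_def by (simp add: mult.commute)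
  with \<open>\<nu> \<noteq> 0\<close> show ?thesis
    unfolding q_def by (rule that)
qed

lemma dress_denom_if_no_real_roots: "\<forall>t. poly g t \<noteq> 0 \<Longrightarrow> dress_denom g"
proof (induction "degree g" arbitrary: g rule: less_induct)
  case less
  show ?case
  proof (cases "degree g = 0")
    case True
    then have g: "g = [:coeff g 0:]"
      by (simp add: degree_0_id)
    with less.prems have "coeff g 0 \<noteq> 0"
      by (metis poly_const_conv)
    then show ?thesis
      by (subst g) (rule dress_denom_const)
  next
    case False
    then obtain \<mu> \<nu> s where "\<nu> \<noteq> 0" and g: "g = ([:- \<mu>, 1:]\<^sup>2 + [:\<nu>\<^sup>2:]) * s"
      using quadratic_factor_if_no_real_roots[OF less.prems] by blast
    have quadratic: "degree ([:- \<mu>, 1:]\<^sup>2 + [:\<nu>\<^sup>2:]) = 2"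
      by (rule degree_shifted_sum_square)
    moreover have "s \<noteq> 0"
      using g less.prems by auto
    ultimately have "degree s < degree g"
      unfolding g by (subst degree_mult_eq) auto
    moreover have "\<forall>t. poly s t \<noteq> 0"
      using less.prems g by auto
    ultimately have "dress_denom s"
      using less.hyps by blast
    with \<open>\<nu> \<noteq> 0\<close> \<open>s \<noteq> 0\<close> quadratic show ?thesis
      unfolding g by (intro dress_denom_mult dress_denom_quadratic) auto
  qed
qed

section \<open>Factoring the row\<close>

lemma quadratics_with_nonconstant_gcd:
  fixes x y :: "real poly"
  assumes "degree x = 2" and "degree y = 2" and "degree (gcd x y) \<noteq> 0"
  obtains (proportional) \<kappa> where "\<kappa> \<noteq> 0" and "y = smult \<kappa> x"
  | (common_linear_factor) s r1 r2 c \<delta> where "x = s * r1" and "y = s * r2" and "degree s = 1"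
      and "degree r2 = 1" and "\<delta> \<noteq> 0" and "r1 - smult c r2 = [:\<delta>:]"
proof -
  define s where "s = gcd x y"
  obtain r1 r2 where x: "x = s * r1" and y: "y = s * r2"
    unfolding s_def by (meson dvdE gcd_dvd1 gcd_dvd2)
  have "r1 \<noteq> 0" "r2 \<noteq> 0" "s \<noteq> 0"
    using x y assms(1,2) by auto
  then have deg: "degree s + degree r1 = 2" "degree s + degree r2 = 2"
    using x y assms(1,2) by (metis degree_mult_eq)+
  define c where "c = lead_coeff r1 / lead_coeff r2"
  define \<delta> where "\<delta> = coeff (r1 - smult c r2) 0"
  have "coeff (r1 - smult c r2) k = 0" if "k \<ge> 1" for k
  proof (cases "k = degree r1")
    case True
    moreover have "degree r1 = degree r2"
      using deg by simp
    ultimately show ?thesis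
      using \<open>r2 \<noteq> 0\<close> unfolding c_def by simp
  next
    case False
    with that deg assms(3) have "k > degree r1" "k > degree r2"
      unfolding s_def by linarith+
    then show ?thesis
      by (simp add: coeff_eq_0)
  qed
  then have r1: "r1 - smult c r2 = [:\<delta>:]"
    unfolding \<delta>_def by (intro poly_eqI) (auto simp: coeff_pCons split: nat.split)
  show ?thesis
  proof (cases "\<delta> = 0")
    case True
    then have "x = smult c y"
      using r1 x y by (simp add: algebra_simps)
    moreover have "c \<noteq> 0"
      unfolding c_def using \<open>r1 \<noteq> 0\<close> \<open>r2 \<noteq> 0\<close> by simp
    ultimately show ?thesis
      by (intro proportional[of "inverse c"]) simp_all
  next
    case False
    have "degree r2 \<noteq> 0"
    proof
      assume "degree r2 = 0"
      then have "degree r1 = 0"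
        using deg by simp
      with \<open>degree r2 = 0\<close> \<open>r2 \<noteq> 0\<close> False show False
        using leading_coeff_neq_0[of r2] unfolding \<delta>_def c_def by simp
    qed
    with deg assms(3) have "degree s = 1" "degree r2 = 1"
      unfolding s_def by linarith+
    with x y False r1 show ?thesis
      by (intro common_linear_factor)
  qed
qed

lemma mat2_mult:
  "mat2 a b c d ** mat2 a' b' c' d' = mat2 (a * a' + b * c') (a * b' + b * d') (c * a' + d * c') (c * b' + d * d')"
  unfolding mat2_def matrix_matrix_mult_def by (simp add: vec_eq_iff sum_2 forall_2)

lemma matrix_over_mat2: "matrix_over S (mat2 a b c d) \<longleftrightarrow> a \<in> S \<and> b \<in> S \<and> c \<in> S \<and> d \<in> S"
  unfolding matrix_over_def mat2_def by (auto simp: forall_2)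

lemma idempotent_mat2:
  fixes a b c d :: "'a::comm_ring_1"
  assumes "a + d = 1" and "a * d = b * c"
  shows "idempotent_mat (mat2 a b c d)"
proof -
  have "a * a + b * c = a * (a + d)" "a * b + b * d = b * (a + d)"
    "c * a + d * c = c * (a + d)" "c * b + d * d = d * (a + d)"
    using assms(2) by (simp_all add: algebra_simps)
  then show ?thesis
    unfolding idempotent_mat_def mat2_mult assms(1) by simp
qed

lemma mat2_row_mult_column: "mat2 1 b 0 0 ** mat2 0 0 c 1 = mat2 (b * c) b 0 0"
  by (simp add: mat2_mult)

lemma product_of_idempotents_proportional_row:
  fixes S :: "'a::field set"
  assumes "0 \<in> S" "1 \<in> S" "\<kappa> * p \<in> S" "inverse \<kappa> \<in> S" and "\<kappa> \<noteq> 0"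
  shows "product_of_idempotents_over S (mat2 p (\<kappa> * p) 0 0)"
  unfolding product_of_idempotents_over_def
proof (intro exI[of _ "[mat2 1 (\<kappa> * p) 0 0, mat2 0 0 (inverse \<kappa>) 1]"] conjI ballI)
  show "mat2 p (\<kappa> * p) 0 0 = foldr (**) [mat2 1 (\<kappa> * p) 0 0, mat2 0 0 (inverse \<kappa>) 1] (mat 1)"
    using \<open>\<kappa> \<noteq> 0\<close> by (simp add: mat2_row_mult_column field_simps)
qed (use assms in \<open>auto simp: matrix_over_mat2 intro: idempotent_mat2\<close>)

lemma product_of_idempotents_rank_one:
  fixes S :: "'a::comm_ring_1 set"
  assumes "0 \<in> S" "1 \<in> S" "\<beta> \<in> S" "c \<in> S"
    and "\<alpha>1 * \<rho>1 \<in> S" "\<alpha>1 * \<rho>2 \<in> S" "\<alpha>2 * \<rho>1 \<in> S" "\<alpha>2 * \<rho>2 \<in> S"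
    and "\<alpha>1 * \<rho>1 + \<alpha>2 * \<rho>2 = 1"
  shows "product_of_idempotents_over S
    (mat2 (\<beta> * (c * \<alpha>1 + \<alpha>2) * \<rho>1) (\<beta> * (c * \<alpha>1 + \<alpha>2) * \<rho>2) 0 0)"
  unfolding product_of_idempotents_over_def
proof (intro exI[of _ "[mat2 1 \<beta> 0 0, mat2 0 0 c 1, mat2 (\<alpha>1 * \<rho>1) (\<alpha>1 * \<rho>2) (\<alpha>2 * \<rho>1) (\<alpha>2 * \<rho>2)]"]
    conjI ballI)
  show "mat2 (\<beta> * (c * \<alpha>1 + \<alpha>2) * \<rho>1) (\<beta> * (c * \<alpha>1 + \<alpha>2) * \<rho>2) 0 0 =
      foldr (**) [mat2 1 \<beta> 0 0, mat2 0 0 c 1, mat2 (\<alpha>1 * \<rho>1) (\<alpha>1 * \<rho>2) (\<alpha>2 * \<rho>1) (\<alpha>2 * \<rho>2)] (mat 1)"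
    by (simp add: matrix_mul_assoc mat2_row_mult_column mat2_mult algebra_simps)
qed (use assms in \<open>auto simp: matrix_over_mat2 intro!: idempotent_mat2\<close>)

text \<open>Take \<open>a\<^sub>2 = k s - c a\<^sub>1\<close>; then \<open>a\<^sub>1 r\<^sub>1 + a\<^sub>2 r\<^sub>2 = \<delta> a\<^sub>1 + k s r\<^sub>2\<close>, so \<open>a\<^sub>1\<close> is forced to be
  \<open>(G - k s r\<^sub>2) / \<delta>\<close>, which is linear for the \<open>k\<close> cancelling the leading coefficient of \<open>G\<close>.\<close>
lemma linear_cofactors:
  fixes s r1 r2 G :: "real poly"
  assumes "degree s = 1" and "degree r2 = 1" and "degree G = 2"
    and "\<delta> \<noteq> 0" and "r1 - smult c r2 = [:\<delta>:]"
  obtains a1 a2 k where "k \<noteq> 0" and "degree a1 \<le> 1" and "degree a2 \<le> 1"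
    and "a1 * r1 + a2 * r2 = G" and "smult c a1 + a2 = smult k s"
proof -
  define k where "k = lead_coeff G / (lead_coeff s * lead_coeff r2)"
  define a1 where "a1 = smult (1 / \<delta>) (G - smult k (s * r2))"
  define a2 where "a2 = smult k s - smult c a1"
  have "s \<noteq> 0" "r2 \<noteq> 0" "G \<noteq> 0"
    using assms(1-3) by auto
  then have "k \<noteq> 0"
    unfolding k_def by simp
  have "coeff (s * r2) 2 = lead_coeff s * lead_coeff r2"
    using coeff_mult_degree_sum[of s r2] assms(1,2) by (simp add: numeral_2_eq_2)
  then have "coeff (G - smult k (s * r2)) i = 0" if "i \<ge> 2" for i
    using that degree_mult_le[of s r2] assms(1-3) leading_coeff_neq_0[OF \<open>s \<noteq> 0\<close>]
      leading_coeff_neq_0[OF \<open>r2 \<noteq> 0\<close>]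
    by (cases "i = 2") (auto simp: k_def coeff_eq_0)
  then have deg_a1: "degree a1 \<le> 1"
    unfolding a1_def by (intro degree_le) auto
  moreover have "degree a2 \<le> 1"
    unfolding a2_def using deg_a1 assms(1) by (intro degree_diff_le) auto
  moreover have "a1 * r1 + a2 * r2 = a1 * (r1 - smult c r2) + smult k (s * r2)"
    unfolding a2_def by (simp add: algebra_simps)
  then have "a1 * r1 + a2 * r2 = G"
    unfolding assms(5) a1_def using \<open>\<delta> \<noteq> 0\<close> by simp
  moreover have "smult c a1 + a2 = smult k s"
    unfolding a2_def by simp
  ultimately show ?thesis
    using \<open>k \<noteq> 0\<close> that by blast
qed

lemma product_of_idempotents_common_linear_factor:
  fixes s r1 r2 G \<gamma> :: "real poly"
  assumes "degree s = 1" and "degree r2 = 1" and "\<delta> \<noteq> 0" and r1: "r1 - smult c r2 = [:\<delta>:]"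
    and "degree G = 2" and "dress_denom G"
    and "\<gamma> \<noteq> 0" and "2 \<le> degree \<gamma>" and "dress_denom \<gamma>"
  shows "product_of_idempotents_over dress_min (mat2 (Fract (s * r1) \<gamma>) (Fract (s * r2) \<gamma>) 0 0)"
proof -
  obtain a1 a2 k where "k \<noteq> 0" and deg_a: "degree a1 \<le> 1" "degree a2 \<le> 1"
    and bezout: "a1 * r1 + a2 * r2 = G" and comb: "smult c a1 + a2 = smult k s"
    using linear_cofactors[OF assms(1,2,5,3) r1] by blast
  have "G \<noteq> 0"
    using \<open>degree G = 2\<close> by auto
  have "r1 = smult c r2 + [:\<delta>:]"
    using r1 by (simp add: diff_eq_eq)
  then have "degree r1 \<le> 1"
    using \<open>degree r2 = 1\<close> by (auto intro!: degree_add_le order.trans[OF degree_smult_le])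
  have entry_in: "to_fract a * to_fract r / to_fract G \<in> dress_min" if "degree a \<le> 1" "degree r \<le> 1" for a r
  proof -
    have "degree (a * r) \<le> degree G"
      using degree_mult_le[of a r] that \<open>degree G = 2\<close> by linarith
    with \<open>dress_denom G\<close> have "Fract (a * r) G \<in> dress_min"
      unfolding dress_denom_def by blast
    then show ?thesis
      by (simp add: Fract_conv_to_fract)
  qed
  define \<beta> where "\<beta> = to_fract (smult (1 / k) G) / to_fract \<gamma>"
  have "\<beta> \<in> dress_min"
    using \<open>dress_denom \<gamma>\<close> \<open>k \<noteq> 0\<close> \<open>degree G = 2\<close> \<open>2 \<le> degree \<gamma>\<close>
    unfolding \<beta>_def dress_denom_def by (simp add: Fract_conv_to_fract)
  have "\<beta> * (const_fract c * (to_fract a1 / to_fract G) + to_fract a2 / to_fract G)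
      = to_fract s / to_fract \<gamma>"
  proof -
    have "const_fract c * to_fract a1 + to_fract a2 = const_fract k * to_fract s"
      using arg_cong[OF comb, of to_fract] by (simp only: to_fract_add to_fract_smult)
    then show ?thesis
      unfolding \<beta>_def to_fract_smult using \<open>G \<noteq> 0\<close> \<open>\<gamma> \<noteq> 0\<close> \<open>k \<noteq> 0\<close>
      by (simp add: field_simps const_fract_simps)
  qed
  moreover have "to_fract a1 / to_fract G * to_fract r1 + to_fract a2 / to_fract G * to_fract r2 = 1"
    using arg_cong[OF bezout, of to_fract] \<open>G \<noteq> 0\<close> by (simp add: field_simps)
  ultimately have "product_of_idempotents_over dress_min
      (mat2 (to_fract s / to_fract \<gamma> * to_fract r1) (to_fract s / to_fract \<gamma> * to_fract r2) 0 0)"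
    using product_of_idempotents_rank_one[of dress_min \<beta> "const_fract c"
        "to_fract a1 / to_fract G" "to_fract r1" "to_fract r2" "to_fract a2 / to_fract G"]
      \<open>\<beta> \<in> dress_min\<close> entry_in deg_a \<open>degree r1 \<le> 1\<close> \<open>degree r2 = 1\<close>
    by (simp add: dress_min_0 dress_min_1 const_fract_in_dress_min)
  then show ?thesis
    by (simp add: Fract_conv_to_fract)
qed

theorem proposition3p5:
  fixes x y \<gamma> :: "real poly"
  assumes "degree x = 2" and "degree y = 2"
    and "\<forall>t::real. poly \<gamma> t \<noteq> 0"
    and "Fract x \<gamma> \<in> dress_min" and "Fract y \<gamma> \<in> dress_min"
    and "degree (gcd x y) \<noteq> 0"
  shows "product_of_idempotents_over dress_min (mat2 (Fract x \<gamma>) (Fract y \<gamma>) 0 0)"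
proof -
  have "\<gamma> \<noteq> 0"
    using assms(3) by auto
  then have "2 \<le> degree \<gamma>"
    using degree_le_if_Fract_in_dress_min[OF assms(4)] assms(1) by simp
  have "dress_denom \<gamma>"
    using assms(3) by (rule dress_denom_if_no_real_roots)
  from assms(1,2,6) show ?thesis
  proof (cases rule: quadratics_with_nonconstant_gcd)
    case (proportional \<kappa>)
    then have y: "Fract y \<gamma> = const_fract \<kappa> * Fract x \<gamma>"
      by (simp add: Fract_conv_to_fract to_fract_smult)
    have "inverse (const_fract \<kappa>) \<in> dress_min"
      by (simp flip: const_fract_inverse add: const_fract_in_dress_min)
    then show ?thesis
      using assms(5) \<open>\<kappa> \<noteq> 0\<close> unfolding y
      by (intro product_of_idempotents_proportional_row) (simp_all add: dress_min_0 dress_min_1)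
  next
    case (common_linear_factor s r1 r2 c \<delta>)
    define G :: "real poly" where "G = [:- 0, 1:]\<^sup>2 + [:1\<^sup>2:]"
    have "dress_denom G"
      unfolding G_def by (rule dress_denom_quadratic) simp
    moreover have "degree G = 2"
      unfolding G_def by (rule degree_shifted_sum_square)
    ultimately show ?thesis
      unfolding common_linear_factor(1,2) using common_linear_factor \<open>\<gamma> \<noteq> 0\<close> \<open>2 \<le> degree \<gamma>\<close>
        \<open>dress_denom \<gamma>\<close> by (intro product_of_idempotents_common_linear_factor)
  qed
qed

end
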